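(* Let $d\geq 2$ and $n\geq 2d$ be integers with $n$ divisible by $2d$. Let $T(n,2d)$ be the complete balanced $2d$-partite graph with parts $V_{1,1},V_{1,-1},\ldots,V_{d,1},V_{d,-1}$, each of size $n/(2d)$, and let $q^{\diamond}:V(T(n,2d))\to\mathbb{R}^d$ map every vertex of $V_{i,s}$ to $s e_i$, where $e_1,\ldots,e_d$ is the standard basis of $\mathbb{R}^d$ (so the parts are mapped to the distinct vertices of the regular crosspolytope $\mathrm{conv}\{\pm e_1,\ldots,\pm e_d\}$). Then the spectrum of $L(T(n,2d),q^{\diamond})$ is \[ \left\{0^{(d(d+1)/2)},\;\left(\tfrac{n}{2d}\right)^{(n(d-1)-d^2)},\;\left(\tfrac{n}{d}\right)^{(d(d-1)/2)},\;\left(\tfrac{n}{2}\right)^{(n-1)},\;n^{(1)}\right\}, \] where the superscript $(m)$ indicates multiplicity $m$.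
   Context: For a graph $G=(V,E)$ and a map $p:V\to\mathbb{R}^d$, for distinct $u,v\in V$ let $d_{uv}=\frac{p(u)-p(v)}{\|p(u)-p(v)\|}$ if $p(u)\neq p(v)$ and $d_{uv}=0$ otherwise. The normalized rigidity matrix $R(G,p)$ is the $d|V|\times|E|$ real matrix whose column indexed by the edge $\{u,v\}$ is $(1_u-1_v)\otimes d_{uv}$, where $\{1_u\}$ is the standard basis of $\mathbb{R}^{|V|}$ and $\otimes$ is the Kronecker product. The stiffness matrix is $L(G,p)=R(G,p)R(G,p)^t$. The complete balanced $r$-partite graph $T(n,r)$ has vertex set a disjoint union of $r$ parts of size $n/r$ and edges all pairs of vertices lying in different parts. *)

theory Defs
  imports
    "HOL-Library.Disjoint_Sets"
    "HOL-Computational_Algebra.Polynomial"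
    "Jordan_Normal_Form.Spectral_Radius"
begin

type_synonym 'v graph = "'v set \<times> 'v set set"

definition complete_multipartite :: "'i set \<Rightarrow> ('i \<Rightarrow> 'v set) \<Rightarrow> 'v graph" where
  "complete_multipartite I P =
     ((\<Union>i\<in>I. P i), {{u, v} | u v. \<exists>i\<in>I. \<exists>j\<in>I. i \<noteq> j \<and> u \<in> P i \<and> v \<in> P j})"

text \<open>The families of parts of the graphs \<open>T(n,r)\<close>, where \<open>r = card I\<close>.\<close>

definition balanced_parts :: "nat \<Rightarrow> 'i set \<Rightarrow> ('i \<Rightarrow> 'v set) \<Rightarrow> bool" where
  "balanced_parts n I P \<longleftrightarrow>
     finite I \<and> card I dvd n \<and> disjoint_family_on P I \<and>
     (\<forall>i\<in>I. finite (P i) \<and> card (P i) = n div card I)"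

text \<open>The rows and columns of the rigidity matrix are indexed by vertices and edges. To get
  matrices with numbered rows and columns, the vertices are listed in \<open>vs\<close>, and the edges in
  \<open>es\<close>, each edge being listed exactly once as an ordered pair of its endpoints. The order of
  the two endpoints is irrelevant, see \<open>rigidity_column_swap\<close>.\<close>

definition enumerates :: "'v list \<Rightarrow> ('v \<times> 'v) list \<Rightarrow> 'v graph \<Rightarrow> bool" where
  "enumerates vs es G \<longleftrightarrow>
     distinct vs \<and> set vs = fst G \<and>
     distinct (map (\<lambda>(u, v). {u, v}) es) \<and> set (map (\<lambda>(u, v). {u, v}) es) = snd G"

definition vnorm :: "real vec \<Rightarrow> real" where
  "vnorm x = sqrt (x \<bullet> x)"

definition edge_direction :: "nat \<Rightarrow> ('v \<Rightarrow> real vec) \<Rightarrow> 'v \<Rightarrow> 'v \<Rightarrow> real vec" where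
  "edge_direction d p u v =
     (if p u \<noteq> p v then (1 / vnorm (p u - p v)) \<cdot>\<^sub>v (p u - p v) else 0\<^sub>v d)"

definition vertex_vec :: "'v list \<Rightarrow> 'v \<Rightarrow> real vec" where
  "vertex_vec vs u = vec (length vs) (\<lambda>a. if vs ! a = u then 1 else 0)"

definition kronecker_vec :: "real vec \<Rightarrow> real vec \<Rightarrow> real vec" where
  "kronecker_vec x y =
     vec (dim_vec x * dim_vec y) (\<lambda>i. x $ (i div dim_vec y) * y $ (i mod dim_vec y))"

definition rigidity_column ::
  "nat \<Rightarrow> 'v list \<Rightarrow> ('v \<Rightarrow> real vec) \<Rightarrow> 'v \<Rightarrow> 'v \<Rightarrow> real vec" where
  "rigidity_column d vs p u v =
     kronecker_vec (vertex_vec vs u - vertex_vec vs v) (edge_direction d p u v)"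

definition rigidity_matrix ::
  "nat \<Rightarrow> 'v list \<Rightarrow> ('v \<times> 'v) list \<Rightarrow> ('v \<Rightarrow> real vec) \<Rightarrow> real mat" where
  "rigidity_matrix d vs es p =
     mat_of_cols (d * length vs) (map (\<lambda>(u, v). rigidity_column d vs p u v) es)"

definition stiffness_matrix ::
  "nat \<Rightarrow> 'v list \<Rightarrow> ('v \<times> 'v) list \<Rightarrow> ('v \<Rightarrow> real vec) \<Rightarrow> real mat" where
  "stiffness_matrix d vs es p =
     rigidity_matrix d vs es p * (rigidity_matrix d vs es p)\<^sup>T"

text \<open>Eigenvalues with (algebraic) multiplicity.\<close>

definition spectrum_mset :: "'a :: idom mat \<Rightarrow> 'a multiset" where
  "spectrum_mset A = proots (char_poly A)"

lemma set_spectrum_mset: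
  fixes A :: "'a :: field mat"
  assumes "A \<in> carrier_mat n n"
  shows "set_mset (spectrum_mset A) = spectrum A"
proof -
  have "char_poly A \<noteq> 0"
    using degree_monic_char_poly[OF assms] by auto
  thus ?thesis
    using eigenvalue_root_char_poly[OF assms] by (auto simp: spectrum_mset_def spectrum_def)
qed

lemma rigidity_column_swap:
  assumes "p u \<in> carrier_vec d" "p v \<in> carrier_vec d"
  shows "rigidity_column d vs p v u = rigidity_column d vs p u v"
proof -
  have neg: "p v - p u = - (p u - p v)"
    using assms by (intro eq_vecI) auto
  have "vnorm (p v - p u) = vnorm (p u - p v)"
    unfolding neg vnorm_def using assms by simp
  hence dir: "edge_direction d p v u = - edge_direction d p u v"
    unfolding edge_direction_def using assms by (intro eq_vecI) (auto simp: diff_divide_distrib)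
  have dm: "dim_vec (edge_direction d p u v) = d"
    unfolding edge_direction_def using assms by auto
  have "i mod d < d \<and> i div d < length vs" if "i < length vs * d" for i
  proof -
    have "0 < d" using that by (cases "d = 0") auto
    thus ?thesis using that less_mult_imp_div_less by simp
  qed
  thus ?thesis
    unfolding rigidity_column_def kronecker_vec_def dir
    by (intro eq_vecI) (auto simp: dm vertex_vec_def algebra_simps)
qed

lemma enumerates_exists:
  assumes "finite (fst G)" "snd G \<subseteq> {{u, v} | u v. u \<in> fst G \<and> v \<in> fst G}"
  shows "\<exists>vs es. enumerates vs es G"
proof -
  have "snd G \<subseteq> Pow (fst G)" using assms(2) by auto
  hence "finite (snd G)" using assms(1) finite_subset by blast
  then obtain ls where ls: "distinct ls" "set ls = snd G"
    using finite_distinct_list[of "snd G"] by auto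
  define g :: "'a \<times> 'a \<Rightarrow> 'a set" where "g = (\<lambda>(u, v). {u, v})"
  have ex: "\<exists>uv. g uv = e" if "e \<in> set ls" for e
  proof -
    have "e \<in> {{u, v} | u v. u \<in> fst G \<and> v \<in> fst G}"
      by (rule subsetD[OF assms(2)]) (use that ls(2) in simp)
    then obtain u v where "e = {u, v}" by auto
    hence "g (u, v) = e" by (simp add: g_def)
    thus ?thesis by blast
  qed
  define f where "f = (\<lambda>e. SOME uv. g uv = e)"
  have f: "g (f e) = e" if "e \<in> set ls" for e
    unfolding f_def by (rule someI_ex[OF ex[OF that]])
  have "map g (map f ls) = ls"
    using f by (simp add: map_idI)
  moreover obtain vs where "distinct vs" "set vs = fst G"
    using assms(1) finite_distinct_list[of "fst G"] by auto
  ultimately have "enumerates vs (map f ls) G"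
    unfolding enumerates_def g_def[symmetric] using ls by simp
  thus ?thesis by (intro exI)
qed

end

theory Submission
  imports Defs "HOL-Library.Function_Algebras"
begin

text \<open>Identify vectors with functions \<open>f (v, l)\<close> of a vertex and a coordinate. If a vertex is in
  \<open>V (i, s)\<close>, then \<open>L\<close> acts on functions with mean zero on each part as multiplication by
  \<open>d m\<close> in coordinate \<open>i\<close> and by \<open>m\<close> in the others, where \<open>m = n / (2 d)\<close>. A function constant on
  the parts has the form \<open>f (v, l) = a i l + s * b i l\<close>, and \<open>L\<close> maps it to \<open>m\<close> times the function
  of the same form given by \<open>a' i k = a i k - a k k\<close>, \<open>b' i k = b i k + b k i\<close> for \<open>k \<noteq> i\<close> and
  \<open>a' i i = (\<Sum>j<d. a i i - a j i)\<close>, \<open>b' i i = (\<Sum>j<d. b i i + b j j)\<close>. So every column of \<open>a\<close>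
  carries a star Laplacian, the off-diagonal part of \<open>b\<close> splits into its symmetric and antisymmetric
  part, and the diagonal of \<open>b\<close> into its mean and the rest. This yields \<open>d n\<close> explicit eigenvectors,
  and it suffices that they span.\<close>

section \<open>Spectrum from a spanning family of eigenvectors\<close>

text \<open>Functions with pointwise operations need no carrier set, so \<open>span\<close> and its
  closure rules apply to them directly.\<close>

interpretation pointwise: vector_space "\<lambda>(c :: 'a :: field) (f :: 'x \<Rightarrow> 'a) x. c * f x"
  by unfold_locales (auto simp: fun_eq_iff algebra_simps)

text \<open>\<open>A P = P D\<close> with \<open>P\<close> invertible makes \<open>A\<close> similar
  to the diagonal matrix \<open>D\<close>, so its characteristic polynomial is a product of linear
  factors. For square matrices a right inverse is also a left inverse.\<close>

lemma spectrum_mset_similar_diagonal: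
  fixes A :: "'a :: field mat"
  assumes "A \<in> carrier_mat n n" "P \<in> carrier_mat n n" "Q \<in> carrier_mat n n"
    and PQ: "P * Q = 1\<^sub>m n" and len: "length ls = n"
    and AP: "A * P = P * mat n n (\<lambda>(i, j). if i = j then ls ! i else 0)"
  shows "spectrum_mset A = mset ls"
proof -
  define D where "D = mat n n (\<lambda>(i, j). if i = j then ls ! i else 0)"
  have D: "D \<in> carrier_mat n n" by (simp add: D_def)
  have QP: "Q * P = 1\<^sub>m n"
    by (rule mat_mult_left_right_inverse[OF assms(2,3) PQ])
  have "A = A * (P * Q)" using assms(1) PQ by simp
  also have "\<dots> = A * P * Q"
    by (rule assoc_mult_mat[OF assms(1-3), symmetric])
  also have "A * P = P * D"
    unfolding D_def by (rule AP)
  finally have "similar_mat_wit A D P Q"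
    by (intro similar_mat_witI[OF PQ QP]) (use assms D in auto)
  hence "char_poly A = char_poly D"
    by (intro char_poly_similar) (auto simp: similar_mat_def)
  also have "\<dots> = (\<Prod>a \<leftarrow> diag_mat D. [:- a, 1:])"
    by (rule char_poly_upper_triangular[OF D]) (auto simp: D_def)
  also have "diag_mat D = ls"
    using len by (intro nth_equalityI) (auto simp: diag_mat_def D_def)
  finally have "spectrum_mset A = (\<Sum>p \<leftarrow> map (\<lambda>a. [:- a, 1:]) ls. proots p)"
    unfolding spectrum_mset_def by (subst proots_prod_list[symmetric]) auto
  also have "\<dots> = mset ls" by (induction ls) auto
  finally show ?thesis .
qed

text \<open>Coefficients belong to list positions, since the list may repeat a function. In the
  induction, the new coefficient is added at one position holding \<open>g\<close>.\<close>

lemma pointwise_span_nth: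
  fixes fs :: "('x \<Rightarrow> 'a :: field) list"
  assumes "f \<in> pointwise.span (set fs)"
  shows "\<exists>c. \<forall>x. f x = (\<Sum>i<length fs. (fs ! i) x * c i)"
  using assms
proof (induction rule: pointwise.span_induct_alt)
  case base
  show ?case by (rule exI[of _ "\<lambda>_. 0"]) auto
next
  case (step a g h)
  then obtain c where c: "\<forall>x. h x = (\<Sum>i<length fs. (fs ! i) x * c i)" by blast
  from step obtain k where k: "k < length fs" "fs ! k = g" by (auto simp: in_set_conv_nth)
  have "(\<Sum>i<length fs. (fs ! i) x * (c i + (if i = k then a else 0))) = a * g x + h x" for x
    using k c by (simp add: ring_distribs sum.distrib if_distrib[where f = "\<lambda>y. _ * y"]
      sum.delta mult.commute cong: if_cong)
  thus ?case by (intro exI[of _ "\<lambda>i. c i + (if i = k then a else 0)"]) auto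
qed

text \<open>The columns of \<open>P\<close> are the given eigenvectors; that they span yields a right inverse of
  \<open>P\<close>, which is then a two-sided inverse because there are exactly \<open>n\<close> of them.\<close>

lemma spectrum_mset_spanning:
  fixes A :: "'a :: field mat" and e :: "nat \<Rightarrow> 'x" and B :: "('a \<times> ('x \<Rightarrow> 'a)) multiset"
  assumes A: "A \<in> carrier_mat n n" and size: "size B = n"
    and eig: "\<And>l f. (l, f) \<in># B \<Longrightarrow> A *\<^sub>v vec n (f \<circ> e) = l \<cdot>\<^sub>v vec n (f \<circ> e)"
    and span: "\<And>j. j < n \<Longrightarrow>
      \<exists>f \<in> pointwise.span (snd ` set_mset B). \<forall>i<n. f (e i) = (if i = j then 1 else 0)"
  shows "spectrum_mset A = image_mset fst B"
proof -
  obtain bs where bs: "mset bs = B" using ex_mset by blast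
  have len: "length bs = n" using bs size by auto
  have setbs: "snd ` set_mset B = set (map snd bs)" using bs by auto
  have "\<exists>c. \<forall>i<n. (\<Sum>k<n. snd (bs ! k) (e i) * c k) = (if i = j then 1 else 0)" if j: "j < n" for j
  proof -
    obtain f where f: "f \<in> pointwise.span (set (map snd bs))"
      "\<forall>i<n. f (e i) = (if i = j then 1 else 0)" using span[OF j] unfolding setbs by blast
    obtain c where "\<forall>x. f x = (\<Sum>i<length bs. (map snd bs ! i) x * c i)"
      using pointwise_span_nth[OF f(1)] by auto
    hence "\<forall>x. f x = (\<Sum>i<n. snd (bs ! i) x * c i)" using len by simp
    thus ?thesis using f(2) by metis
  qed
  then obtain c where
    c: "\<And>i j. i < n \<Longrightarrow> j < n \<Longrightarrow> (\<Sum>k<n. snd (bs ! k) (e i) * c j k) = (if i = j then 1 else 0)"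
    by metis
  define P where "P = mat n n (\<lambda>(i, k). snd (bs ! k) (e i))"
  define Q where "Q = mat n n (\<lambda>(k, j). c j k)"
  define D where "D = mat n n (\<lambda>(i, j). if i = j then map fst bs ! i else 0)"
  have "P * Q = 1\<^sub>m n"
    by (intro eq_matI) (auto simp: P_def Q_def scalar_prod_def c lessThan_atLeast0[symmetric])
  moreover have "A * P = P * D"
  proof (rule eq_matI)
    fix i k assume "i < dim_row (P * D)" "k < dim_col (P * D)"
    hence i: "i < n" and k: "k < n" by (auto simp: P_def D_def)
    have colP: "col P k = vec n (snd (bs ! k) \<circ> e)" using k by (auto simp: P_def)
    have "(A * P) $$ (i, k) = (A *\<^sub>v col P k) $ i"
      using i k A by (simp add: P_def)
    also have "A *\<^sub>v col P k = fst (bs ! k) \<cdot>\<^sub>v col P k"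
      unfolding colP using k len bs by (intro eig) (metis nth_mem_mset prod.collapse)
    also have "\<dots> $ i = fst (bs ! k) * P $$ (i, k)" using i k by (simp add: P_def)
    also have "\<dots> = (\<Sum>j<n. P $$ (i, j) * (if j = k then fst (bs ! j) else 0))"
      using k by (simp add: if_distrib[where f = "\<lambda>y. _ * y"] sum.delta cong: if_cong)
    also have "\<dots> = (P * D) $$ (i, k)"
      using i k len
      by (auto simp: P_def D_def scalar_prod_def lessThan_atLeast0 intro!: sum.cong)
    finally show "(A * P) $$ (i, k) = (P * D) $$ (i, k)" .
  qed (use A in \<open>auto simp: P_def D_def\<close>)
  ultimately have "spectrum_mset A = mset (map fst bs)"
    unfolding D_def
    by (intro spectrum_mset_similar_diagonal[OF A, of P Q]) (auto simp: P_def Q_def len)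
  thus ?thesis by (simp add: bs[symmetric])
qed

text \<open>Used to read an index of a Kronecker product as a pair of a block and a position in the
  block.\<close>

lemma sum_div_mod:
  fixes g :: "nat \<Rightarrow> nat \<Rightarrow> 'b :: comm_monoid_add"
  shows "(\<Sum>i<m * k. g (i div k) (i mod k)) = (\<Sum>a<m. \<Sum>b<k. g a b)"
proof -
  have "(\<Sum>a<m. \<Sum>b<k. g a b) = (\<Sum>a<m. \<Sum>i\<in>{a * k..<a * k + k}. g (i div k) (i mod k))"
  proof (rule sum.cong)
    fix a
    show "(\<Sum>b<k. g a b) = (\<Sum>i\<in>{a * k..<a * k + k}. g (i div k) (i mod k))"
      by (rule sum.reindex_bij_witness[where i = "\<lambda>i. i - a * k" and j = "\<lambda>b. a * k + b"]) auto
  qed simp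
  also have "\<dots> = (\<Sum>i<m * k. g (i div k) (i mod k))" by (rule sum.nat_group)
  finally show ?thesis by simp
qed

section \<open>Stiffness matrices as operators on functions\<close>

text \<open>This is the entry of \<open>R\<^sup>T f\<close> at an edge: the relative velocity of the
  endpoints along the edge. The incidence factor of the Kronecker product selects the blocks of
  \<open>u\<close> and \<open>v\<close>.\<close>

lemma scalar_prod_rigidity_column:
  fixes f :: "'v \<times> nat \<Rightarrow> real"
  assumes "distinct vs" "u \<in> set vs" "v \<in> set vs" "edge_direction d p u v \<in> carrier_vec d"
  shows "rigidity_column d vs p u v \<bullet> vec (d * length vs) (\<lambda>a. f (vs ! (a div d), a mod d)) =
    (\<Sum>l<d. edge_direction d p u v $ l * (f (u, l) - f (v, l)))"
proof -
  let ?c = "edge_direction d p u v"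
  have dim: "dim_vec ?c = d" using assms(4) by simp
  \<comment> \<open>Since \<open>vs\<close> is distinct, the indicator of \<open>w\<close> is
    nonzero at exactly one position.\<close>
  have at: "(\<Sum>b<length vs. (if vs ! b = w then 1 else 0) * h (vs ! b)) = h w"
    if w: "w \<in> set vs" for w and h :: "'v \<Rightarrow> real"
  proof -
    obtain k where k: "k < length vs" "vs ! k = w" using w by (auto simp: in_set_conv_nth)
    have "(\<Sum>b<length vs. (if vs ! b = w then 1 else 0) * h (vs ! b)) =
        (\<Sum>b<length vs. if b = k then h w else 0)"
      using k assms(1) by (intro sum.cong) (auto simp: nth_eq_iff_index_eq)
    thus ?thesis using k by (simp add: sum.delta)
  qed
  have "rigidity_column d vs p u v \<bullet> vec (d * length vs) (\<lambda>a. f (vs ! (a div d), a mod d)) =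
      (\<Sum>a<length vs * d. ((if vs ! (a div d) = u then 1 else 0) - (if vs ! (a div d) = v then 1 else 0))
         * ?c $ (a mod d) * f (vs ! (a div d), a mod d))"
    by (auto simp: scalar_prod_def rigidity_column_def kronecker_vec_def vertex_vec_def dim
      mult.commute[of d] lessThan_atLeast0 less_mult_imp_div_less intro!: sum.cong)
  also have "\<dots> = (\<Sum>b<length vs. \<Sum>l<d. ((if vs ! b = u then 1 else 0) - (if vs ! b = v then 1 else 0))
         * ?c $ l * f (vs ! b, l))"
    by (rule sum_div_mod)
  also have "\<dots> = (\<Sum>l<d. (\<Sum>b<length vs. (if vs ! b = u then 1 else 0) * (?c $ l * f (vs ! b, l)))
       - (\<Sum>b<length vs. (if vs ! b = v then 1 else 0) * (?c $ l * f (vs ! b, l))))"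
    by (subst sum.swap) (simp only: sum_subtractf[symmetric] left_diff_distrib mult.assoc)
  also have "\<dots> = (\<Sum>l<d. ?c $ l * f (u, l) - ?c $ l * f (v, l))"
    by (intro sum.cong refl)
      (simp only: at[OF assms(2), of "\<lambda>w. ?c $ l * f (w, l)" for l]
        at[OF assms(3), of "\<lambda>w. ?c $ l * f (w, l)" for l])
  finally show ?thesis by (simp add: right_diff_distrib)
qed

lemma edge_direction_swap:
  assumes "p u \<in> carrier_vec d" "p v \<in> carrier_vec d"
  shows "edge_direction d p v u = - edge_direction d p u v"
proof -
  have neg: "p v - p u = - (p u - p v)"
    using assms by (intro eq_vecI) auto
  have "vnorm (p v - p u) = vnorm (p u - p v)"
    unfolding neg vnorm_def using assms by simp
  thus ?thesis
    unfolding edge_direction_def using assms by (intro eq_vecI) (auto simp: diff_divide_distrib)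
qed

lemma edge_direction_carrier:
  assumes "p u \<in> carrier_vec d" "p v \<in> carrier_vec d"
  shows "edge_direction d p u v \<in> carrier_vec d"
  using assms by (auto simp: edge_direction_def)

text \<open>The row of \<open>u\<close> in \<open>R\<close> has sign \<open>1\<close> or
  \<open>-1\<close> at an edge, depending on which endpoint of the listed pair is \<open>u\<close>.
  Antisymmetry of \<open>\<phi>\<close> absorbs this sign, so the arbitrary orientations disappear
  and a sum over neighbours remains.\<close>

lemma sum_enumerated_edges:
  fixes \<phi> :: "'v \<Rightarrow> 'v \<Rightarrow> real"
  assumes "enumerates vs es G"
    and edges: "\<And>x y. {x, y} \<in> snd G \<Longrightarrow> x \<noteq> y \<and> x \<in> set vs \<and> y \<in> set vs"
    and anti: "\<And>x y. {x, y} \<in> snd G \<Longrightarrow> \<phi> y x = - \<phi> x y"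
  shows "(\<Sum>(x, y)\<in>set es. ((if x = u then 1 else 0) - (if y = u then 1 else 0)) * \<phi> x y) =
    (\<Sum>v | {u, v} \<in> snd G. \<phi> u v)"
proof -
  define S where "S = {(x, y). {x, y} \<in> snd G}"
  let ?h = "\<lambda>(x, y). if x = u then \<phi> x y else 0"
  have dist: "distinct (map (\<lambda>(u, v). {u, v}) es)" and set: "(\<lambda>(u, v). {u, v}) ` set es = snd G"
    using assms(1) by (auto simp: enumerates_def)
  have inj: "inj_on (\<lambda>(u, v). {u, v}) (set es)"
    using dist by (simp add: distinct_map)
  have es: "(x, y) \<in> set es \<Longrightarrow> {x, y} \<in> snd G" for x y using set by force
  \<comment> \<open>\<open>S\<close> consists of the adjacent ordered pairs, and \<open>es\<close>
    contains exactly one orientation of each edge.\<close>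
  have S: "S = set es \<union> prod.swap ` set es"
  proof
    show "S \<subseteq> set es \<union> prod.swap ` set es"
    proof
      fix z assume "z \<in> S"
      then obtain x y where z: "z = (x, y)" "{x, y} \<in> snd G" by (auto simp: S_def)
      have "{x, y} \<in> (\<lambda>(u, v). {u, v}) ` set es" using z(2) set by simp
      then obtain x' y' where "(x', y') \<in> set es" "{x', y'} = {x, y}" by auto
      thus "z \<in> set es \<union> prod.swap ` set es" using z(1) by (force simp: doubleton_eq_iff)
    qed
    show "set es \<union> prod.swap ` set es \<subseteq> S"
      using es by (auto simp: S_def insert_commute)
  qed
  \<comment> \<open>An edge listed in both orientations would, by injectivity, be a loop.\<close>
  have disj: "set es \<inter> prod.swap ` set es = {}"
  proof (rule ccontr)
    assume "set es \<inter> prod.swap ` set es \<noteq> {}"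
    then obtain x y where xy: "(x, y) \<in> set es" "(y, x) \<in> set es" by auto
    have "(x, y) = (y, x)" by (rule inj_onD[OF inj _ xy]) (simp add: insert_commute)
    thus False using edges[OF es[OF xy(1)]] by simp
  qed
  have "(\<Sum>(x, y)\<in>set es. ((if x = u then 1 else 0) - (if y = u then 1 else 0)) * \<phi> x y) =
     (\<Sum>z\<in>set es. ?h z + ?h (prod.swap z))"
  proof (intro sum.cong refl)
    fix z assume z: "z \<in> set es"
    obtain x y where xy: "z = (x, y)" by (cases z)
    have "\<phi> y x = - \<phi> x y" using anti[OF es] z xy by simp
    thus "(case z of (x, y) \<Rightarrow> ((if x = u then 1 else 0) - (if y = u then 1 else 0)) * \<phi> x y) =
        ?h z + ?h (prod.swap z)"
      by (cases "x = u"; cases "y = u") (auto simp: xy)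
  qed
  also have "\<dots> = sum ?h (set es) + sum ?h (prod.swap ` set es)"
    by (subst sum.reindex) (simp_all only: sum.distrib o_def inj_swap)
  also have "\<dots> = sum ?h S"
    unfolding S by (rule sum.union_disjoint[symmetric]) (use disj in auto)
  also have "\<dots> = sum ?h (Pair u ` {v. {u, v} \<in> snd G})"
  proof (rule sum.mono_neutral_right)
    show "finite S" by (simp add: S)
  qed (auto simp: S_def)
  also have "\<dots> = (\<Sum>v | {u, v} \<in> snd G. \<phi> u v)"
    by (subst sum.reindex) (auto simp: inj_on_def)
  finally show ?thesis .
qed

lemma stiffness_matrix_carrier:
  "stiffness_matrix d vs es p \<in> carrier_mat (d * length vs) (d * length vs)"
  by (simp add: stiffness_matrix_def rigidity_matrix_def carrier_matI)

text \<open>With \<open>L f = R (R\<^sup>T f)\<close>, each edge contributes its column times the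
  scalar product of that column with \<open>f\<close>, and row \<open>a\<close> sees only the edges
  at \<open>u\<close>. Index \<open>a\<close> encodes vertex and coordinate in the order of the
  Kronecker product.\<close>

lemma stiffness_matrix_mult_vec:
  fixes f :: "'v \<times> nat \<Rightarrow> real"
  assumes enum: "enumerates vs es G"
    and edges: "\<And>x y. {x, y} \<in> snd G \<Longrightarrow> x \<noteq> y \<and> x \<in> set vs \<and> y \<in> set vs"
    and p: "\<And>v. v \<in> set vs \<Longrightarrow> p v \<in> carrier_vec d"
    and a: "a < d * length vs" and u: "u = vs ! (a div d)" and k: "k = a mod d"
  shows "(stiffness_matrix d vs es p *\<^sub>v vec (d * length vs) (\<lambda>a. f (vs ! (a div d), a mod d))) $ a =
    (\<Sum>v | {u, v} \<in> snd G. edge_direction d p u v $ k *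
       (\<Sum>l<d. edge_direction d p u v $ l * (f (u, l) - f (v, l))))"
proof -
  define N where "N = d * length vs"
  define x where "x = vec N (\<lambda>a. f (vs ! (a div d), a mod d))"
  define R where "R = rigidity_matrix d vs es p"
  define col where "col = (\<lambda>(u, v). rigidity_column d vs p u v)"
  define \<phi> where "\<phi> = (\<lambda>u v. edge_direction d p u v $ k *
       (\<Sum>l<d. edge_direction d p u v $ l * (f (u, l) - f (v, l))))"
  have distvs: "distinct vs" using enum by (simp add: enumerates_def)
  have distes: "distinct es" using enum by (auto simp: enumerates_def distinct_map)
  have es: "{x, y} \<in> snd G" if "(x, y) \<in> set es" for x y
  proof -
    have "(\<lambda>(u, v). {u, v}) ` set es = snd G" using enum by (auto simp: enumerates_def)
    thus ?thesis using that by force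
  qed
  have dirc: "edge_direction d p y z \<in> carrier_vec d" if "{y, z} \<in> snd G" for y z
    using edges[OF that] p by (intro edge_direction_carrier) auto
  have kd: "k < d" "a div d < length vs"
    using a k by (auto intro: less_mult_imp_div_less simp: mult.commute) (cases "d = 0"; simp)
  have R: "R \<in> carrier_mat N (length es)"
    by (simp add: R_def rigidity_matrix_def N_def carrier_matI)
  have dimcol: "dim_vec (col z) = N" if z: "z \<in> set es" for z
  proof -
    obtain y w where "z = (y, w)" by (cases z)
    thus ?thesis using z dirc[OF es, of y w]
      by (simp add: col_def rigidity_column_def kronecker_vec_def vertex_vec_def N_def)
  qed
  have Rcol: "Matrix.col R i = col (es ! i)" if "i < length es" for i
  proof -
    have "R = mat_of_cols N (map col es)" by (simp add: R_def rigidity_matrix_def N_def col_def)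
    thus ?thesis using that carrier_vecI[OF dimcol] by (simp add: col_mat_of_cols)
  qed
  have x: "x \<in> carrier_vec N" by (simp add: x_def)
  have "stiffness_matrix d vs es p *\<^sub>v x = R *\<^sub>v (R\<^sup>T *\<^sub>v x)"
    unfolding stiffness_matrix_def R_def[symmetric]
    using R x by (intro assoc_mult_mat_vec) auto
  also have "\<dots> $ a = (\<Sum>i<length es. R $$ (a, i) * (Matrix.col R i \<bullet> x))"
    using a R by (auto simp: scalar_prod_def N_def lessThan_atLeast0 intro!: sum.cong)
  also have "\<dots> = (\<Sum>i<length es. col (es ! i) $ a * (col (es ! i) \<bullet> x))"
  proof (intro sum.cong)
    fix i assume i: "i \<in> {..<length es}"
    have "R $$ (a, i) = Matrix.col R i $ a" using i R a by (auto simp: N_def)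
    thus "R $$ (a, i) * (Matrix.col R i \<bullet> x) = col (es ! i) $ a * (col (es ! i) \<bullet> x)"
      using Rcol i by simp
  qed simp
  also have "\<dots> = (\<Sum>z\<in>set es. col z $ a * (col z \<bullet> x))"
    by (rule sum.reindex_bij_betw[OF bij_betw_nth[OF distes refl refl]])
  also have "\<dots> = (\<Sum>(x, y)\<in>set es. ((if x = u then 1 else 0) - (if y = u then 1 else 0)) * \<phi> x y)"
  proof (intro sum.cong refl)
    fix z assume "z \<in> set es"
    moreover obtain y w where "z = (y, w)" by (cases z)
    ultimately have z: "z = (y, w)" "(y, w) \<in> set es" by auto
    note yw = edges[OF es[OF z(2)]] and dc = dirc[OF es[OF z(2)]]
    have "col z \<bullet> x = (\<Sum>l<d. edge_direction d p y w $ l * (f (y, l) - f (w, l)))"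
      unfolding x_def N_def col_def z(1) using yw dc distvs
      by (auto intro!: scalar_prod_rigidity_column)
    moreover have "col z $ a = ((if y = u then 1 else 0) - (if w = u then 1 else 0)) * edge_direction d p y w $ k"
      using dc a kd u k unfolding col_def z(1)
      by (auto simp: rigidity_column_def kronecker_vec_def vertex_vec_def mult.commute)
    ultimately show "col z $ a * (col z \<bullet> x) =
        (case z of (x, y) \<Rightarrow> ((if x = u then 1 else 0) - (if y = u then 1 else 0)) * \<phi> x y)"
      by (simp add: z(1) \<phi>_def)
  qed
  also have "\<dots> = (\<Sum>v | {u, v} \<in> snd G. \<phi> u v)"
  proof (rule sum_enumerated_edges[OF enum edges])
    fix y w assume yw: "{y, w} \<in> snd G"
    have c: "edge_direction d p w y = - edge_direction d p y w" "edge_direction d p y w \<in> carrier_vec d"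
      using edges[OF yw] p by (auto intro!: edge_direction_swap edge_direction_carrier)
    \<comment> \<open>Swapping the endpoints negates both factors of each summand, so only the outer
      direction entry in \<open>\<phi>\<close> changes sign.\<close>
    have "(\<Sum>l<d. edge_direction d p w y $ l * (f (w, l) - f (y, l))) =
        (\<Sum>l<d. edge_direction d p y w $ l * (f (y, l) - f (w, l)))"
      using c by (intro sum.cong) (auto simp: algebra_simps)
    thus "\<phi> w y = - \<phi> y w" using c kd by (simp add: \<phi>_def)
  qed auto
  finally show ?thesis by (simp add: x_def N_def \<phi>_def)
qed

section \<open>The stiffness operator of the crosspolytope\<close>

text \<open>Vertex \<open>v\<close> is thought of as placed at \<open>\<sigma> v\<close> times the
  unit vector of axis \<open>\<iota> v\<close>. Signs are real because they enter the operator as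
  factors.\<close>

locale crosspolytope_parts =
  fixes d m :: nat and U :: "'v set" and \<iota> :: "'v \<Rightarrow> nat" and \<sigma> :: "'v \<Rightarrow> real"
  assumes d2: "d \<ge> 2" and m0: "m > 0" and finite_U: "finite U"
    and axis: "v \<in> U \<Longrightarrow> \<iota> v < d"
    and sign: "v \<in> U \<Longrightarrow> \<sigma> v = 1 \<or> \<sigma> v = -1"
    and card_part: "j < d \<Longrightarrow> t = 1 \<or> t = -1 \<Longrightarrow> card {v \<in> U. \<iota> v = j \<and> \<sigma> v = t} = m"
begin

text \<open>The denominator is the squared distance of the two images. Vertices of the part of \<open>u\<close>, where
  that distance is \<open>0\<close> instead of \<open>4\<close>, may be included in the sum because their numerator vanishes.\<close>

definition stiffness :: "('v \<times> nat \<Rightarrow> real) \<Rightarrow> 'v \<Rightarrow> nat \<Rightarrow> real" where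
  "stiffness f u k = (\<Sum>v\<in>U.
     ((if k = \<iota> u then \<sigma> u else 0) - (if k = \<iota> v then \<sigma> v else 0)) *
     (\<sigma> u * (f (u, \<iota> u) - f (v, \<iota> u)) - \<sigma> v * (f (u, \<iota> v) - f (v, \<iota> v))) /
     (if \<iota> u = \<iota> v then 4 else 2))"

text \<open>On a pair of opposite parts, \<open>a\<close> is the mean of the two values and
  \<open>b\<close> half their difference. The value 0 elsewhere makes \<open>lift\<close> depend
  only on entries with indices below \<open>d\<close>.\<close>

definition lift :: "(nat \<Rightarrow> nat \<Rightarrow> real) \<Rightarrow> (nat \<Rightarrow> nat \<Rightarrow> real) \<Rightarrow> 'v \<times> nat \<Rightarrow> real" where
  "lift a b = (\<lambda>(v, l). if v \<in> U \<and> l < d then a (\<iota> v) l + \<sigma> v * b (\<iota> v) l else 0)"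

text \<open>The chosen predicate depends only on the part of \<open>v\<close>, so all vertices of a
  part share one representative.\<close>

definition rep :: "'v \<Rightarrow> 'v" where
  "rep v = (SOME w. w \<in> U \<and> \<iota> w = \<iota> v \<and> \<sigma> w = \<sigma> v)"

text \<open>These functions have mean zero on every part, and \<open>diff v k\<close> vanishes when
  \<open>v\<close> is its own representative.\<close>

definition diff :: "'v \<Rightarrow> nat \<Rightarrow> 'v \<times> nat \<Rightarrow> real" where
  "diff v k = (\<lambda>(w, l). if l = k then (if w = v then 1 else 0) - (if w = rep v then 1 else 0) else 0)"

section \<open>Sums over parts and their representatives\<close>

lemma sum_parts:
  fixes \<phi> :: "nat \<Rightarrow> real \<Rightarrow> real"
  shows "(\<Sum>v\<in>U. \<phi> (\<iota> v) (\<sigma> v)) = m * (\<Sum>j<d. \<phi> j 1 + \<phi> j (-1))"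
proof -
  let ?T = "{..<d} \<times> {1, -1 :: real}"
  have "(\<Sum>v\<in>U. \<phi> (\<iota> v) (\<sigma> v)) =
      (\<Sum>y\<in>?T. \<Sum>v\<in>{v \<in> U. (\<iota> v, \<sigma> v) = y}. \<phi> (\<iota> v) (\<sigma> v))"
    using axis sign finite_U by (intro sum.group[symmetric]) auto
  also have "\<dots> = (\<Sum>(j, t)\<in>?T. m * \<phi> j t)"
  proof (rule sum.cong)
    fix y assume "y \<in> ?T"
    then obtain j t where y: "y = (j, t)" "j < d" "t = 1 \<or> t = -1" by auto
    have "(\<Sum>v\<in>{v \<in> U. (\<iota> v, \<sigma> v) = y}. \<phi> (\<iota> v) (\<sigma> v)) = (\<Sum>v\<in>{v \<in> U. \<iota> v = j \<and> \<sigma> v = t}. \<phi> j t)"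
      using y(1) by (intro sum.cong) auto
    thus "(\<Sum>v\<in>{v \<in> U. (\<iota> v, \<sigma> v) = y}. \<phi> (\<iota> v) (\<sigma> v)) = (case y of (j, t) \<Rightarrow> m * \<phi> j t)"
      using card_part[OF y(2,3)] y(1) by simp
  qed simp
  also have "\<dots> = m * (\<Sum>j<d. \<phi> j 1 + \<phi> j (-1))"
    by (subst sum.cartesian_product[symmetric]) (simp add: sum_distrib_left distrib_left)
  finally show ?thesis .
qed

lemma card_U: "card U = 2 * d * m"
proof -
  have "real (card U) = real (2 * d * m)" using sum_parts[of "\<lambda>_ _. 1"] by simp
  thus ?thesis by (simp only: of_nat_eq_iff)
qed

lemma rep:
  assumes "v \<in> U"
  shows "rep v \<in> U" "\<iota> (rep v) = \<iota> v" "\<sigma> (rep v) = \<sigma> v"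
proof -
  have "rep v \<in> U \<and> \<iota> (rep v) = \<iota> v \<and> \<sigma> (rep v) = \<sigma> v"
    unfolding rep_def
    by (rule someI[where P = "\<lambda>w. w \<in> U \<and> \<iota> w = \<iota> v \<and> \<sigma> w = \<sigma> v" and x = v])
      (simp add: assms)
  thus "rep v \<in> U" "\<iota> (rep v) = \<iota> v" "\<sigma> (rep v) = \<sigma> v" by auto
qed

lemma rep_cong: "\<iota> v = \<iota> w \<Longrightarrow> \<sigma> v = \<sigma> w \<Longrightarrow> rep v = rep w"
  by (simp add: rep_def)

text \<open>No part is empty because \<open>m > 0\<close>, so there are \<open>2 * d\<close>
  representatives. As \<open>rep\<close> is idempotent, they are exactly its fixed points.\<close>

lemma card_nonreps: "card {v \<in> U. rep v \<noteq> v} = 2 * d * m - 2 * d"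
proof -
  have "inj_on (\<lambda>v. (\<iota> v, \<sigma> v)) (rep ` U)"
    using rep by (auto simp: inj_on_def intro!: rep_cong)
  moreover have "(\<lambda>v. (\<iota> v, \<sigma> v)) ` rep ` U = {..<d} \<times> {1, -1}"
  proof
    show "{..<d} \<times> {1, -1} \<subseteq> (\<lambda>v. (\<iota> v, \<sigma> v)) ` rep ` U"
    proof
      fix y assume "y \<in> {..<d} \<times> {1, -1 :: real}"
      then obtain j t where y: "y = (j, t)" "j < d" "t = 1 \<or> t = -1" by auto
      have "{v \<in> U. \<iota> v = j \<and> \<sigma> v = t} \<noteq> {}" using card_part[OF y(2,3)] m0 by force
      then obtain v where "v \<in> U" "\<iota> v = j" "\<sigma> v = t" by blast
      thus "y \<in> (\<lambda>v. (\<iota> v, \<sigma> v)) ` rep ` U" 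
        using rep[of v] y(1) by (intro image_eqI[of _ _ "rep v"] imageI[of v]) auto
    qed
  qed (use rep axis sign in force)
  ultimately have "card (rep ` U) = card ({..<d} \<times> {1, -1 :: real})"
    by (metis card_image)
  hence "card (rep ` U) = 2 * d" by (simp add: card_cartesian_product)
  moreover have "{v \<in> U. rep v \<noteq> v} = U - rep ` U"
  proof -
    have "rep (rep w) = rep w" if "w \<in> U" for w
      by (rule rep_cong) (simp_all add: rep that)
    moreover have "v \<in> rep ` U" if "v \<in> U" "rep v = v" for v
      using that by (metis imageI)
    ultimately show ?thesis by auto
  qed
  moreover have "rep ` U \<subseteq> U" using rep by auto
  ultimately show ?thesis using finite_U card_U by (simp add: card_Diff_subset finite_subset)
qed

text \<open>The summands depend on \<open>v\<close> only through its part, and adding those of two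
  opposite parts cancels everything odd in the sign \<open>t\<close>.\<close>

lemma stiffness_lift:
  assumes "u \<in> U" "k < d"
  defines "i \<equiv> \<iota> u"
  shows "stiffness (lift a b) u k = m *
    ((if k = i then \<Sum>j<d. a i i - a j i else a i k - a k k) +
     \<sigma> u * (if k = i then \<Sum>j<d. b i i + b j j else b i k + b k i))"
proof -
  define s where "s = \<sigma> u"
  have i: "i < d" using axis assms by simp
  have s: "s = 1 \<or> s = -1" using sign assms by (simp add: s_def)
  define \<phi> where "\<phi> j t = ((if k = i then s else 0) - (if k = j then t else 0)) *
     (s * ((a i i + s * b i i) - (a j i + t * b j i)) - t * ((a i j + s * b i j) - (a j j + t * b j j))) /
     (if i = j then 4 else 2)" for j t
  have "stiffness (lift a b) u k = (\<Sum>v\<in>U. \<phi> (\<iota> v) (\<sigma> v))"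
    unfolding stiffness_def \<phi>_def lift_def using assms axis i
    by (intro sum.cong) (auto simp: s_def)
  also have "\<dots> = m * (\<Sum>j<d. \<phi> j 1 + \<phi> j (-1))" by (rule sum_parts)
  \<comment> \<open>For \<open>k = i\<close> the axis \<open>j = i\<close> fits the general formula:
    the part of \<open>u\<close> gives 0, and the opposite part, at squared distance 4, gives
    \<open>2 * s * b i i\<close>. For \<open>k \<noteq> i\<close> only the axis \<open>j = k\<close>
    contributes.\<close>
  also have "(\<Sum>j<d. \<phi> j 1 + \<phi> j (-1)) = (\<Sum>j<d. if k = i then (a i i - a j i) + s * (b i i + b j j)
      else if j = k then (a i k - a k k) + s * (b i k + b k i) else 0)"
    using s by (intro sum.cong) (auto simp: \<phi>_def field_simps)
  also have "\<dots> = (if k = i then \<Sum>j<d. a i i - a j i else a i k - a k k) +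
     s * (if k = i then \<Sum>j<d. b i i + b j j else b i k + b k i)"
    using assms(2) by (simp add: sum.distrib sum_distrib_left[symmetric])
  finally show ?thesis by (simp add: s_def)
qed

text \<open>The values at the neighbours cancel because \<open>w\<close> and \<open>rep w\<close>
  lie in the same part. What remains is the diagonal block of \<open>L\<close> at \<open>u\<close>,
  which is \<open>d * m\<close> along the axis of \<open>u\<close> and \<open>m\<close> across
  it.\<close>

lemma stiffness_diff:
  assumes "u \<in> U" "k < d" "w \<in> U" "l < d"
  shows "stiffness (diff w l) u k = (if l = \<iota> w then real d * m else m) * diff w l (u, k)"
proof -
  define i s where "i = \<iota> u" and "s = \<sigma> u"
  have i: "i < d" using axis assms by (simp add: i_def)
  have s: "s = 1 \<or> s = -1" using sign assms by (simp add: s_def)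
  define f where "f k = diff w l (u, k)" for k
  \<comment> \<open>\<open>\<phi>\<close> collects the values at \<open>u\<close>, and
    \<open>\<psi>\<close> is the coefficient of the value at \<open>v\<close>. Both depend on
    \<open>v\<close> only through its part.\<close>
  define \<phi> where "\<phi> j t = ((if k = i then s else 0) - (if k = j then t else 0)) *
     (s * f i - t * f j) / (if i = j then 4 else 2)" for j t
  define \<psi> where "\<psi> j t = ((if k = i then s else 0) - (if k = j then t else 0)) *
     (s * (if i = l then 1 else 0) - t * (if j = l then 1 else 0)) / (if i = j then 4 else 2)" for j t
  let ?e = "\<lambda>v. (if v = w then 1 else 0) - (if v = rep w then 1 else 0 :: real)"
  have "stiffness (diff w l) u k =
      (\<Sum>v\<in>U. \<phi> (\<iota> v) (\<sigma> v) - \<psi> (\<iota> v) (\<sigma> v) * ?e v)"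
    unfolding stiffness_def
  proof (intro sum.cong refl)
    fix v
    have alg: "K * (p * (x - y * z) - q * (x' - y' * z)) / D =
        K * (p * x - q * x') / D - K * (p * y - q * y') / D * z" for K p q x y z x' y' D :: real
      by (simp add: right_diff_distrib left_diff_distrib diff_divide_distrib mult_ac)
    have "diff w l (v, l') = (if l' = l then 1 else 0) * ?e v" for l'
      by (simp add: diff_def)
    thus "((if k = \<iota> u then \<sigma> u else 0) - (if k = \<iota> v then \<sigma> v else 0)) *
        (\<sigma> u * (diff w l (u, \<iota> u) - diff w l (v, \<iota> u)) - \<sigma> v * (diff w l (u, \<iota> v) - diff w l (v, \<iota> v))) /
        (if \<iota> u = \<iota> v then 4 else 2) = \<phi> (\<iota> v) (\<sigma> v) - \<psi> (\<iota> v) (\<sigma> v) * ?e v"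
      unfolding \<phi>_def \<psi>_def f_def[symmetric] i_def[symmetric] s_def[symmetric]
      by (simp only: alg)
  qed
  also have "\<dots> = (\<Sum>v\<in>U. \<phi> (\<iota> v) (\<sigma> v)) - (\<Sum>v\<in>U. \<psi> (\<iota> v) (\<sigma> v) * ?e v)"
    by (rule sum_subtractf)
  also have "(\<Sum>v\<in>U. \<psi> (\<iota> v) (\<sigma> v) * ?e v) = \<psi> (\<iota> w) (\<sigma> w) - \<psi> (\<iota> (rep w)) (\<sigma> (rep w))"
    using assms(3) rep(1)[OF assms(3)] finite_U
    by (simp add: right_diff_distrib sum_subtractf sum.delta if_distrib[where f = "\<lambda>y. _ * y"]
      del: mult_minus_right cong: if_cong)
  also have "\<dots> = 0" using rep[OF assms(3)] by simp
  also have "(\<Sum>v\<in>U. \<phi> (\<iota> v) (\<sigma> v)) = m * (\<Sum>j<d. \<phi> j 1 + \<phi> j (-1))" by (rule sum_parts)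
  also have "(\<Sum>j<d. \<phi> j 1 + \<phi> j (-1)) = (\<Sum>j<d. if k = i then f i else if j = k then f k else 0)"
    using s by (intro sum.cong) (auto simp: \<phi>_def field_simps)
  also have "\<dots> = (if k = i then d * f i else f k)"
    using assms(2) by simp
  \<comment> \<open>Where \<open>diff w l\<close> is nonzero, \<open>u\<close> lies on the axis of
    \<open>w\<close> and \<open>k = l\<close>, so the case \<open>k = i\<close> becomes
    \<open>l = \<iota> w\<close>.\<close>
  finally show ?thesis
    using rep(2)[OF assms(3)] by (auto simp: f_def i_def diff_def)
qed

end

section \<open>A basis of eigenvectors\<close>

text \<open>With a multiset, multiplicity is the cardinality of the index set, whether or not
  \<open>F\<close> is injective. Linear independence comes later from spanning and the total
  count.\<close>

definition eigenfamily :: "'a \<Rightarrow> ('i \<Rightarrow> 'b) \<Rightarrow> 'i set \<Rightarrow> ('a \<times> 'b) multiset" where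
  "eigenfamily c F S = image_mset (\<lambda>x. (c, F x)) (mset_set S)"

lemma fst_eigenfamily [simp]: "image_mset fst (eigenfamily c F S) = replicate_mset (card S) c"
  by (simp add: eigenfamily_def image_mset.compositionality o_def image_mset_const_eq)

lemma set_eigenfamily: "finite S \<Longrightarrow> set_mset (eigenfamily c F S) = (\<lambda>x. (c, F x)) ` S"
  by (simp add: eigenfamily_def)

lemma pointwise_span_add:
  "f \<in> pointwise.span S \<Longrightarrow> g \<in> pointwise.span S \<Longrightarrow> (\<lambda>x. f x + g x) \<in> pointwise.span S"
  using pointwise.span_add[of f S g] by (simp add: plus_fun_def)

lemma pointwise_span_diff:
  "f \<in> pointwise.span S \<Longrightarrow> g \<in> pointwise.span S \<Longrightarrow> (\<lambda>x. f x - g x) \<in> pointwise.span S"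
  using pointwise.span_diff[of f S g] by (simp add: fun_diff_def)

lemma pointwise_span_sum:
  assumes "\<And>i. i \<in> I \<Longrightarrow> f i \<in> pointwise.span S"
  shows "(\<lambda>x. \<Sum>i\<in>I. f i x) \<in> pointwise.span S"
  using assms
proof (induction I rule: infinite_finite_induct)
  case (insert i I)
  thus ?case using pointwise_span_add[of "f i" S "\<lambda>x. \<Sum>i\<in>I. f i x"] by simp
qed (use pointwise.span_zero[of S] in \<open>simp_all add: zero_fun_def\<close>)

lemma card_less_pairs: "card {(i, j). i < j \<and> j < d} = d * (d - 1) div 2" for d :: nat
proof -
  have "{(i, j). i < j \<and> j < d} = prod.swap ` Sigma {..<d} (\<lambda>j. {..<j})" by force
  hence "card {(i, j). i < j \<and> j < d} = card (Sigma {..<d} (\<lambda>j. {..<j}))"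
    by (simp add: card_image)
  also have "\<dots> = \<Sum>{..<d}" by (subst card_SigmaI) auto
  finally show ?thesis using Sum_Ico_nat[of 0 d] by (simp add: lessThan_atLeast0)
qed

section \<open>The nine families of eigenvectors\<close>

context crosspolytope_parts
begin

definition single :: "nat \<Rightarrow> nat \<Rightarrow> nat \<Rightarrow> nat \<Rightarrow> real" where
  "single i j = (\<lambda>x y. if x = i \<and> y = j then 1 else 0)"

text \<open>A reference leaf of the star centred at \<open>k\<close>, which exists below
  \<open>d\<close> since \<open>d \<ge> 2\<close>.\<close>

definition other :: "nat \<Rightarrow> nat" where
  "other k = (if k = 0 then 1 else 0)"

definition column :: "nat \<Rightarrow> nat \<Rightarrow> nat \<Rightarrow> real" where
  "column k = (\<lambda>x y. if y = k then 1 else 0)"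

text \<open>Column \<open>k\<close> is the eigenvector of the Laplacian of the star with
  \<open>d\<close> vertices and centre \<open>k\<close> for its largest eigenvalue \<open>d\<close>;
  \<open>column k\<close> is the kernel vector.\<close>

definition star :: "nat \<Rightarrow> nat \<Rightarrow> nat \<Rightarrow> real" where
  "star k = (\<lambda>x y. if y = k then (if x = k then real d - 1 else - 1) else 0)"

abbreviation "rotations \<equiv>
  eigenfamily (0 :: real) (\<lambda>(i, j). lift (\<lambda>_ _. 0) (single i j - single j i)) {(i, j). i < j \<and> j < d}"

abbreviation "translations \<equiv>
  eigenfamily (0 :: real) (\<lambda>k. lift (column k) (\<lambda>_ _. 0)) {..<d}"

text \<open>Differences of two leaves of a star have Laplacian eigenvalue 1; \<open>other k\<close>
  is the leaf compared against.\<close>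

abbreviation "even_differences \<equiv>
  eigenfamily (real m) (\<lambda>(k, j). lift (single j k - single (other k) k) (\<lambda>_ _. 0))
       (Sigma {..<d} (\<lambda>k. {..<d} - {k, other k}))"

abbreviation "tangential_differences \<equiv>
  eigenfamily (real m) (\<lambda>(v, k). diff v k)
       (Sigma {v \<in> U. rep v \<noteq> v} (\<lambda>v. {..<d} - {\<iota> v}))"

abbreviation "shears \<equiv>
  eigenfamily (2 * real m) (\<lambda>(i, j). lift (\<lambda>_ _. 0) (single i j + single j i)) {(i, j). i < j \<and> j < d}"

abbreviation "stars \<equiv>
  eigenfamily (real d * real m) (\<lambda>k. lift (star k) (\<lambda>_ _. 0)) {..<d}"

text \<open>On the diagonal of \<open>b\<close> the operator is \<open>m\<close> times the sum of
  \<open>d\<close> times the identity and the all-ones matrix. It has factor \<open>d\<close> on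
  trace zero and \<open>2 * d\<close> on the constant diagonal, which is
  \<open>dilation\<close>.\<close>

abbreviation "diagonal_differences \<equiv>
  eigenfamily (real d * real m) (\<lambda>i. lift (\<lambda>_ _. 0) (single i i - single 0 0)) {1..<d}"

abbreviation "radial_differences \<equiv>
  eigenfamily (real d * real m) (\<lambda>v. diff v (\<iota> v)) {v \<in> U. rep v \<noteq> v}"

abbreviation "dilation \<equiv>
  eigenfamily (2 * real d * real m) (\<lambda>_. lift (\<lambda>_ _. 0) (\<lambda>x y. if x = y then 1 else 0)) {()}"

definition basis :: "(real \<times> ('v \<times> nat \<Rightarrow> real)) multiset" where
  "basis = rotations + translations + even_differences + tangential_differences + shears
     + stars + diagonal_differences + radial_differences + dilation"

section \<open>Multiplicities and the total count\<close>

lemma finite_pairs [simp]: "finite {(i, j). i < j \<and> j < d}"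
  by (rule finite_subset[of _ "{..<d} \<times> {..<d}"]) auto

lemma other: "k < d \<Longrightarrow> other k < d" "other k \<noteq> k"
  using d2 by (auto simp: other_def)

lemma fst_basis:
  "image_mset fst basis =
      replicate_mset (d * (d + 1) div 2) 0
    + replicate_mset (2 * d * m * (d - 1) - d\<^sup>2) (real m)
    + replicate_mset (d * (d - 1) div 2) (2 * real m)
    + replicate_mset (2 * d * m - 1) (real d * real m)
    + replicate_mset 1 (2 * real d * real m)"
proof -
  have repl: "replicate_mset a x + replicate_mset b x = replicate_mset (a + b) x" for a b and x :: real
    by (induction a) auto
  have c1: "card (Sigma {..<d} (\<lambda>k. {..<d} - {k, other k})) = d * (d - 2)"
  proof -
    have "card ({..<d} - {k, other k}) = d - 2" if "k < d" for k
      using that other[of k] by (subst card_Diff_subset) auto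
    thus ?thesis by (subst card_SigmaI) auto
  qed
  have c2: "card (Sigma {v \<in> U. rep v \<noteq> v} (\<lambda>v. {..<d} - {\<iota> v})) = (2 * d * m - 2 * d) * (d - 1)"
  proof -
    have "card ({..<d} - {\<iota> v}) = d - 1" if "v \<in> U" for v
      using axis[OF that] by (subst card_Diff_subset) auto
    thus ?thesis using finite_U card_nonreps by (subst card_SigmaI) auto
  qed
  \<comment> \<open>Writing \<open>d = e + 2\<close> and \<open>m = l + 1\<close> removes truncated
    subtraction from the identities below.\<close>
  obtain e where e: "d = e + 2" using d2 by (metis add.commute le_Suc_ex)
  obtain l where l: "m = l + 1" using m0 by (metis Suc_eq_plus1 gr0_conv_Suc)
  \<comment> \<open>The sums combine families with equal eigenvalue: the infinitesimal isometries
    for 0, then two families for \<open>m\<close>, then three for \<open>d * m\<close>.\<close>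
  have a1: "d * (d - 1) div 2 + d = d * (d + 1) div 2"
    by (simp add: e algebra_simps)
  have a2: "d * (d - 2) + (2 * d * m - 2 * d) * (d - 1) = 2 * d * m * (d - 1) - d\<^sup>2"
    by (simp add: e l algebra_simps power2_eq_square)
  have a3: "d + (d - 1) + (2 * d * m - 2 * d) = 2 * d * m - 1"
    by (simp add: e l algebra_simps)
  have "image_mset fst basis =
      replicate_mset (d * (d - 1) div 2 + d) 0
    + replicate_mset (d * (d - 2) + (2 * d * m - 2 * d) * (d - 1)) (real m)
    + replicate_mset (d * (d - 1) div 2) (2 * real m)
    + replicate_mset (d + (d - 1) + (2 * d * m - 2 * d)) (real d * real m)
    + replicate_mset 1 (2 * real d * real m)"
    unfolding basis_def image_mset_union fst_eigenfamily card_less_pairs c1 c2 card_nonreps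
    by (simp add: repl[symmetric] add_ac)
  thus ?thesis unfolding a1 a2 a3 .
qed

text \<open>The count equals the dimension, which is what turns spanning into being a basis.\<close>

lemma size_basis: "size basis = d * (2 * d * m)"
proof -
  have "size basis = size (image_mset fst basis)" by simp
  also have "\<dots> = d * (d + 1) div 2 + (2 * d * m * (d - 1) - d\<^sup>2) + d * (d - 1) div 2 + (2 * d * m - 1) + 1"
    unfolding fst_basis by simp
  also have "\<dots> = d * (2 * d * m)"
  proof -
    obtain e where e: "d = e + 2" using d2 by (metis add.commute le_Suc_ex)
    obtain l where l: "m = l + 1" using m0 by (metis Suc_eq_plus1 gr0_conv_Suc)
    have "d * (d + 1) div 2 = d * (d - 1) div 2 + d" by (simp add: e algebra_simps)
    \<comment> \<open>Parity makes the division by 2 exact, so the two triangular numbers add up to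
      \<open>d * d\<close>.\<close>
    moreover have "even (d * (d - 1))" by (cases d) auto
    hence "2 * (d * (d - 1) div 2) = d * (d - 1)" by (rule dvd_mult_div_cancel)
    hence "d * (d - 1) div 2 + d * (d - 1) div 2 = d * (d - 1)" by linarith
    ultimately have "d * (d + 1) div 2 + d * (d - 1) div 2 = d * d" 
      by (simp add: e algebra_simps)
    moreover have "d * d + (2 * d * m * (d - 1) - d\<^sup>2) + (2 * d * m - 1) + 1 = d * (2 * d * m)"
      by (simp add: e l algebra_simps power2_eq_square)
    ultimately show ?thesis by linarith
  qed
  finally show ?thesis .
qed

section \<open>The eigenvector equations\<close>

lemma lift_apply: "u \<in> U \<Longrightarrow> k < d \<Longrightarrow> lift a b (u, k) = a (\<iota> u) k + \<sigma> u * b (\<iota> u) k"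
  by (simp add: lift_def)

lemma stiffness_basis:
  assumes "(c, f) \<in># basis" "u \<in> U" "k < d"
  shows "stiffness f u k = c * f (u, k)"
proof -
  have i: "\<iota> u < d" using axis assms by simp
  have W: "finite {v \<in> U. rep v \<noteq> v}" using finite_U by simp
  show ?thesis
    using assms(1) unfolding basis_def set_mset_union Un_iff
  proof (elim disjE)
    assume "(c, f) \<in># tangential_differences"
    thus ?thesis using assms W by (auto simp: stiffness_diff set_eigenfamily split: if_splits)
  next
    assume "(c, f) \<in># radial_differences"
    thus ?thesis using assms W axis by (auto simp: stiffness_diff set_eigenfamily split: if_splits)
  next
    assume "(c, f) \<in># rotations"
    thus ?thesis using assms i by (auto simp: set_eigenfamily stiffness_lift single_def)
  next
    assume "(c, f) \<in># translations"
    thus ?thesis using assms i by (auto simp: set_eigenfamily stiffness_lift column_def)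
  next
    assume "(c, f) \<in># even_differences"
    then obtain l j where l: "c = real m" "f = lift (single j l - single (other l) l) (\<lambda>_ _. 0)"
      "l < d" "j < d" "j \<noteq> l" by (auto simp: set_eigenfamily)
    \<comment> \<open>The entries sum to zero over the leaves and vanish at the centre, so the
      equation at the centre reads \<open>0 = 0\<close>, while each leaf reproduces its value times
      \<open>m\<close>.\<close>
    have "(\<Sum>x<d. single j l x y - single (other l) l x y) = 0" for y
      using l other[of l] by (cases "y = l") (simp_all add: single_def sum_subtractf)
    hence "(\<Sum>x<d. single (other l) l x y) = (\<Sum>x<d. single j l x y)" for y
      by (simp add: sum_subtractf)
    moreover have "single j l y y = 0" "single (other l) l y y = 0" for y
      using l(5) other(2)[of l] by (auto simp: single_def)
    ultimately show ?thesis using assms(2,3)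
      by (cases "k = \<iota> u"; cases "k = l")
        (simp_all add: l stiffness_lift lift_apply sum_subtractf sum_negf)
  next
    assume "(c, f) \<in># shears"
    thus ?thesis using assms i by (auto simp: set_eigenfamily stiffness_lift single_def lift_apply)
  next
    assume "(c, f) \<in># stars"
    then obtain l where l: "c = real d * real m" "f = lift (star l) (\<lambda>_ _. 0)" "l < d" by (auto simp: set_eigenfamily)
    \<comment> \<open>The centre contributes 0 and each of the \<open>d - 1\<close> leaves
      contributes \<open>d\<close>, in total \<open>d\<close> times the value at the centre.\<close>
    have "(\<Sum>j<d. star l l l - star l j l) = (\<Sum>j<d. if j = l then 0 else real d)"
      by (intro sum.cong) (auto simp: star_def)
    also have "\<dots> = (\<Sum>j<d. real d) - (\<Sum>j<d. if j = l then real d else 0)"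
      unfolding sum_subtractf[symmetric] by (intro sum.cong) auto
    also have "\<dots> = real d * (real d - 1)" using l(3) by (simp add: algebra_simps)
    finally have "(\<Sum>j<d. star l l l - star l j l) = real d * (real d - 1)" .
    moreover have "star l x k = 0" if "k \<noteq> l" for x k using that by (simp add: star_def)
    ultimately show ?thesis using assms i l
      by (cases "k = l") (auto simp: stiffness_lift lift_apply, auto simp: star_def algebra_simps)
  next
    assume "(c, f) \<in># diagonal_differences"
    thus ?thesis using assms i by (auto simp: set_eigenfamily stiffness_lift single_def lift_apply sum.distrib sum_subtractf)
  next
    assume "(c, f) \<in># dilation"
    thus ?thesis using assms i by (auto simp: set_eigenfamily stiffness_lift lift_apply sum.distrib)
  qed
qed

section \<open>The families span all functions on vertices and coordinates\<close>

abbreviation basis_span :: "('v \<times> nat \<Rightarrow> real) set" where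
  "basis_span \<equiv> pointwise.span (snd ` set_mset basis)"

lemma basis_in_span: "(c, f) \<in># basis \<Longrightarrow> f \<in> basis_span"
  by (intro pointwise.span_base) force

text \<open>The facts follow the order of the families in \<open>basis\<close> and are cited below
  by position.\<close>

lemma in_basis:
  "i < j \<Longrightarrow> j < d \<Longrightarrow> (0, lift (\<lambda>_ _. 0) (single i j - single j i)) \<in># basis"
  "k < d \<Longrightarrow> (0, lift (column k) (\<lambda>_ _. 0)) \<in># basis"
  "k < d \<Longrightarrow> j < d \<Longrightarrow> j \<noteq> k \<Longrightarrow> j \<noteq> other k \<Longrightarrow>
     (real m, lift (single j k - single (other k) k) (\<lambda>_ _. 0)) \<in># basis"
  "v \<in> U \<Longrightarrow> rep v \<noteq> v \<Longrightarrow> k < d \<Longrightarrow> k \<noteq> \<iota> v \<Longrightarrow> (real m, diff v k) \<in># basis"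
  "i < j \<Longrightarrow> j < d \<Longrightarrow> (2 * real m, lift (\<lambda>_ _. 0) (single i j + single j i)) \<in># basis"
  "k < d \<Longrightarrow> (real d * real m, lift (star k) (\<lambda>_ _. 0)) \<in># basis"
  "1 \<le> i \<Longrightarrow> i < d \<Longrightarrow> (real d * real m, lift (\<lambda>_ _. 0) (single i i - single 0 0)) \<in># basis"
  "v \<in> U \<Longrightarrow> rep v \<noteq> v \<Longrightarrow> (real d * real m, diff v (\<iota> v)) \<in># basis"
  "(2 * real d * real m, lift (\<lambda>_ _. 0) (\<lambda>x y. if x = y then 1 else 0)) \<in># basis"
proof -
  have U: "finite {v \<in> U. rep v \<noteq> v}" using finite_U by simp
  show "(0, lift (\<lambda>_ _. 0) (single i j - single j i)) \<in># basis" if "i < j" "j < d"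
  proof -
    have "(0, lift (\<lambda>_ _. 0) (single i j - single j i)) \<in># rotations" using that U by (force simp: set_eigenfamily)
    thus ?thesis by (simp add: basis_def)
  qed
  show "(0, lift (column k) (\<lambda>_ _. 0)) \<in># basis" if "k < d"
  proof -
    have "(0, lift (column k) (\<lambda>_ _. 0)) \<in># translations" using that U by (force simp: set_eigenfamily)
    thus ?thesis by (simp add: basis_def)
  qed
  show "(real m, lift (single j k - single (other k) k) (\<lambda>_ _. 0)) \<in># basis" if "k < d" "j < d" "j \<noteq> k" "j \<noteq> other k"
  proof -
    have "(real m, lift (single j k - single (other k) k) (\<lambda>_ _. 0)) \<in># even_differences" using that U by (force simp: set_eigenfamily)
    thus ?thesis by (simp add: basis_def)
  qed
  show "(real m, diff v k) \<in># basis" if "v \<in> U" "rep v \<noteq> v" "k < d" "k \<noteq> \<iota> v"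
  proof -
    have "(real m, diff v k) \<in># tangential_differences" using that U by (force simp: set_eigenfamily)
    thus ?thesis by (simp add: basis_def)
  qed
  show "(2 * real m, lift (\<lambda>_ _. 0) (single i j + single j i)) \<in># basis" if "i < j" "j < d"
  proof -
    have "(2 * real m, lift (\<lambda>_ _. 0) (single i j + single j i)) \<in># shears" using that U by (force simp: set_eigenfamily)
    thus ?thesis by (simp add: basis_def)
  qed
  show "(real d * real m, lift (star k) (\<lambda>_ _. 0)) \<in># basis" if "k < d"
  proof -
    have "(real d * real m, lift (star k) (\<lambda>_ _. 0)) \<in># stars" using that U by (force simp: set_eigenfamily)
    thus ?thesis by (simp add: basis_def)
  qed
  show "(real d * real m, lift (\<lambda>_ _. 0) (single i i - single 0 0)) \<in># basis" if "1 \<le> i" "i < d"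
  proof -
    have "(real d * real m, lift (\<lambda>_ _. 0) (single i i - single 0 0)) \<in># diagonal_differences" using that U by (force simp: set_eigenfamily)
    thus ?thesis by (simp add: basis_def)
  qed
  show "(real d * real m, diff v (\<iota> v)) \<in># basis" if "v \<in> U" "rep v \<noteq> v"
  proof -
    have "(real d * real m, diff v (\<iota> v)) \<in># radial_differences" using that U by (force simp: set_eigenfamily)
    thus ?thesis by (simp add: basis_def)
  qed
  show "(2 * real d * real m, lift (\<lambda>_ _. 0) (\<lambda>x y. if x = y then 1 else 0)) \<in># basis"
  proof -
    have "(2 * real d * real m, lift (\<lambda>_ _. 0) (\<lambda>x y. if x = y then 1 else 0)) \<in># dilation" by (simp add: set_eigenfamily)
    thus ?thesis by (simp add: basis_def)
  qed
qed

text \<open>\<open>lift\<close> is linear in the pair \<open>a\<close>, \<open>b\<close>, so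
  spanning can be checked on coefficient matrices.\<close>

lemma lift_span_add:
  assumes "lift a b \<in> basis_span" "lift a' b' \<in> basis_span"
  shows "lift (\<lambda>x y. a x y + a' x y) (\<lambda>x y. b x y + b' x y) \<in> basis_span"
proof -
  have "lift (\<lambda>x y. a x y + a' x y) (\<lambda>x y. b x y + b' x y) = (\<lambda>p. lift a b p + lift a' b' p)"
    by (auto simp: lift_def fun_eq_iff algebra_simps)
  thus ?thesis using pointwise_span_add assms by simp
qed

lemma lift_span_scale:
  assumes "lift a b \<in> basis_span"
  shows "lift (\<lambda>x y. c * a x y) (\<lambda>x y. c * b x y) \<in> basis_span"
proof -
  have "lift (\<lambda>x y. c * a x y) (\<lambda>x y. c * b x y) = (\<lambda>p. c * lift a b p)"
    by (auto simp: lift_def fun_eq_iff algebra_simps)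
  thus ?thesis using pointwise.span_scale assms by simp
qed

lemma lift_span_sum:
  assumes "\<And>i. i \<in> I \<Longrightarrow> lift (a i) (b i) \<in> basis_span"
  shows "lift (\<lambda>x y. \<Sum>i\<in>I. a i x y) (\<lambda>x y. \<Sum>i\<in>I. b i x y) \<in> basis_span"
proof -
  have "lift (\<lambda>x y. \<Sum>i\<in>I. a i x y) (\<lambda>x y. \<Sum>i\<in>I. b i x y) = (\<lambda>p. \<Sum>i\<in>I. lift (a i) (b i) p)"
    by (auto simp: lift_def fun_eq_iff sum.distrib sum_distrib_left)
  thus ?thesis using pointwise_span_sum[of I "\<lambda>i. lift (a i) (b i)"] assms by simp
qed

lemma lift_cong:
  assumes "\<And>x y. x < d \<Longrightarrow> y < d \<Longrightarrow> a x y = a' x y" "\<And>x y. x < d \<Longrightarrow> y < d \<Longrightarrow> b x y = b' x y"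
  shows "lift a b = lift a' b'"
  using assms axis by (auto simp: lift_def fun_eq_iff)

text \<open>Within column \<open>k\<close>, the kernel vector and the star vector isolate the
  centre, and then the leaf differences isolate the reference leaf and every other leaf.\<close>

lemma lift_even_single_in_span:
  assumes k: "k < d" and j: "j < d"
  shows "lift (single j k) (\<lambda>_ _. 0) \<in> basis_span"
proof -
  note col = in_basis(2)[OF k, THEN basis_in_span]
  have diag: "lift (single k k) (\<lambda>_ _. 0) \<in> basis_span"
  proof -
    \<comment> \<open>\<open>column k + star k\<close> is \<open>d\<close> at the centre and 0
      elsewhere. The zeros are spelled out so that the closure rules for \<open>lift\<close>
      match.\<close>
    have "lift (single k k) (\<lambda>_ _. 0) =
        lift (\<lambda>x y. 1 / d * (column k x y + star k x y)) (\<lambda>x y. 1 / d * (0 + 0))"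
      using k by (intro lift_cong) (auto simp: single_def column_def star_def)
    also have "\<dots> \<in> basis_span"
      by (intro lift_span_scale lift_span_add col in_basis(6)[OF k, THEN basis_in_span])
    finally show ?thesis .
  qed
  let ?o = "other k" and ?J = "{..<d} - {k, other k}"
  have dj: "lift (single j k - single ?o k) (\<lambda>_ _. 0) \<in> basis_span" if "j \<in> ?J" for j
    using that in_basis(3)[OF k, THEN basis_in_span] by simp
  have oth: "lift (single ?o k) (\<lambda>_ _. 0) \<in> basis_span"
  proof -
    have d1: "real (card ?J) = real d - 2"
      using k other[of k] d2 by (subst card_Diff_subset) (auto simp: of_nat_diff)
    \<comment> \<open>Removing from the full column its centre and the \<open>d - 2\<close>
      differences leaves \<open>d - 1\<close> copies of the reference leaf.\<close>
    have "lift (single ?o k) (\<lambda>_ _. 0) =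
       lift (\<lambda>x y. 1 / (real d - 1) * (column k x y + - 1 * (single k k x y + (\<Sum>j\<in>?J. (single j k - single ?o k) x y))))
         (\<lambda>x y. 1 / (real d - 1) * (0 + - 1 * (0 + (\<Sum>j\<in>?J. 0))))"
    proof (rule lift_cong)
      fix x y assume xy: "x < d" "y < d"
      have "(\<Sum>j\<in>?J. (single j k - single ?o k) x y) =
          (\<Sum>j\<in>?J. if j = x then (if y = k then 1 else 0) else 0) - (real d - 2) * single ?o k x y"
        unfolding d1[symmetric] fun_diff_def sum_subtractf
        by (simp add: single_def cong: if_cong)
      also have "\<dots> = (if x \<in> ?J \<and> y = k then 1 else 0) - (real d - 2) * single ?o k x y"
        by (simp add: sum.delta)
      finally have S: "(\<Sum>j\<in>?J. (single j k - single ?o k) x y) =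
          (if x \<in> ?J \<and> y = k then 1 else 0) - (real d - 2) * single ?o k x y" .
      show "single ?o k x y =
         1 / (real d - 1) * (column k x y + - 1 * (single k k x y + (\<Sum>j\<in>?J. (single j k - single ?o k) x y)))"
        unfolding S using other[of k] xy d2 by (auto simp: single_def column_def field_simps)
    qed simp
    also have "\<dots> \<in> basis_span"
      by (intro lift_span_scale lift_span_add lift_span_sum col diag dj)
    finally show ?thesis .
  qed
  show ?thesis
  proof (cases "j \<in> ?J")
    case True
    have "lift (single j k) (\<lambda>_ _. 0) =
        lift (\<lambda>x y. (single j k - single ?o k) x y + single ?o k x y) (\<lambda>x y. 0 + 0)"
      by (intro lift_cong) auto
    also have "\<dots> \<in> basis_span"
      by (intro lift_span_add dj True oth)
    finally show ?thesis .
  qed (use diag oth j in auto)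
qed

text \<open>Off the diagonal, half the sum and half the difference of a shear and a rotation are the
  matrix units. On the diagonal, the dilation and the differences determine one entry and hence
  all.\<close>

lemma lift_odd_single_in_span:
  assumes i: "i < d" and j: "j < d"
  shows "lift (\<lambda>_ _. 0) (single i j) \<in> basis_span"
proof -
  have off: "lift (\<lambda>_ _. 0) (single i j) \<in> basis_span \<and> lift (\<lambda>_ _. 0) (single j i) \<in> basis_span"
    if ij: "i < j" "j < d" for i j
  proof -
    let ?S = "single i j + single j i" and ?D = "single i j - single j i"
    note S = in_basis(5)[OF ij, THEN basis_in_span] and D = in_basis(1)[OF ij, THEN basis_in_span]
    have "lift (\<lambda>_ _. 0) (single i j) = lift (\<lambda>x y. 1 / 2 * (0 + 0)) (\<lambda>x y. 1 / 2 * (?S x y + ?D x y))"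
      by (intro lift_cong) auto
    also have "\<dots> \<in> basis_span"
      by (intro lift_span_scale lift_span_add S D)
    finally have "lift (\<lambda>_ _. 0) (single i j) \<in> basis_span" .
    moreover have "lift (\<lambda>_ _. 0) (single j i) =
        lift (\<lambda>x y. 1 / 2 * (0 + - 1 * 0)) (\<lambda>x y. 1 / 2 * (?S x y + - 1 * ?D x y))"
      by (intro lift_cong) auto
    moreover have "\<dots> \<in> basis_span"
      by (intro lift_span_scale lift_span_add S D)
    ultimately show ?thesis by simp
  qed
  let ?J = "{1..<d}" and ?I = "\<lambda>x y. if x = y then 1 else 0 :: real"
  have di: "lift (\<lambda>_ _. 0) (single i i - single 0 0) \<in> basis_span" if "i \<in> ?J" for i
    using that in_basis(7)[THEN basis_in_span] by simp
  have zero: "lift (\<lambda>_ _. 0) (single 0 0) \<in> basis_span"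
  proof -
    \<comment> \<open>Subtracting the \<open>d - 1\<close> differences from the identity leaves
      \<open>d\<close> times the first diagonal unit.\<close>
    have "lift (\<lambda>_ _. 0) (single 0 0) =
       lift (\<lambda>x y. 1 / d * (0 + - 1 * (\<Sum>i\<in>?J. 0)))
         (\<lambda>x y. 1 / d * (?I x y + - 1 * (\<Sum>i\<in>?J. (single i i - single 0 0) x y)))"
    proof (rule lift_cong)
      fix x y assume xy: "x < d" "y < d"
      have "(\<Sum>i\<in>?J. (single i i - single 0 0) x y) =
          (\<Sum>i\<in>?J. if i = x then (if x = y then 1 else 0) else 0) - (real d - 1) * single 0 0 x y"
        using d2 unfolding fun_diff_def sum_subtractf
        by (simp add: of_nat_diff single_def cong: if_cong)
      also have "\<dots> = (if x \<in> ?J \<and> x = y then 1 else 0) - (real d - 1) * single 0 0 x y"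
        by (simp add: sum.delta)
      finally have S: "(\<Sum>i\<in>?J. (single i i - single 0 0) x y) =
          (if x \<in> ?J \<and> x = y then 1 else 0) - (real d - 1) * single 0 0 x y" .
      show "single 0 0 x y = 1 / d * (?I x y + - 1 * (\<Sum>i\<in>?J. (single i i - single 0 0) x y))"
        unfolding S using xy d2 by (auto simp: single_def field_simps)
    qed simp
    also have "\<dots> \<in> basis_span"
      by (intro lift_span_scale lift_span_add lift_span_sum in_basis(9)[THEN basis_in_span] di)
    finally show ?thesis .
  qed
  have diag: "lift (\<lambda>_ _. 0) (single i i) \<in> basis_span" if "i < d" for i
  proof (cases "i = 0")
    case False
    have "lift (\<lambda>_ _. 0) (single i i) =
        lift (\<lambda>x y. 0 + 0) (\<lambda>x y. (single i i - single 0 0) x y + single 0 0 x y)"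
      by (intro lift_cong) auto
    also have "\<dots> \<in> basis_span"
      using that False by (intro lift_span_add di zero) auto
    finally show ?thesis .
  qed (use zero in simp)
  show ?thesis
    using off[of i j] off[of j i] diag[of i] i j by (cases i j rule: linorder_cases) auto
qed

lemma diff_in_span:
  assumes "v \<in> U" "k < d"
  shows "diff v k \<in> basis_span"
proof (cases "rep v = v")
  case True
  hence "diff v k = 0" by (auto simp: diff_def fun_eq_iff)
  thus ?thesis by (simp add: pointwise.span_zero)
next
  case False
  thus ?thesis using in_basis(4)[of v k] in_basis(8)[of v] assms basis_in_span
    by (cases "k = \<iota> v") auto
qed

text \<open>Adding \<open>diff v k\<close> to the unit function at the representative gives the one
  at \<open>v\<close>. The former is \<open>1 / m\<close> times the indicator of the part minus all
  differences in that part.\<close>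

lemma unit_in_span:
  assumes v: "v \<in> U" and k: "k < d"
  shows "(\<lambda>p. if p = (v, k) then 1 else 0) \<in> basis_span"
proof -
  define i s where "i = \<iota> v" and "s = \<sigma> v"
  have i: "i < d" using axis[OF v] by (simp add: i_def)
  have s: "s = 1 \<or> s = -1" using sign[OF v] by (simp add: s_def)
  let ?P = "{w \<in> U. \<iota> w = i \<and> \<sigma> w = s}"
  have P: "finite ?P" using finite_U by simp
  have rP: "rep w = rep v" if "w \<in> ?P" for w
    using that by (intro rep_cong) (auto simp: i_def s_def)
  \<comment> \<open>The indicator of the part on axis \<open>i\<close> with sign \<open>s\<close>:
    on that axis \<open>(1 + s * \<sigma> w) / 2\<close> is 1 for the sign \<open>s\<close> and 0
    for the opposite one.\<close>
  define F where "F = lift (\<lambda>x y. 1 / 2 * (single i k x y + s * 0)) (\<lambda>x y. 1 / 2 * (0 + s * single i k x y))"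
  have F: "F \<in> basis_span"
    unfolding F_def
    by (intro lift_span_scale lift_span_add lift_even_single_in_span lift_odd_single_in_span i k)
  have F_eq: "F p = (if fst p \<in> ?P \<and> snd p = k then 1 else 0)" for p
    using s k sign[of "fst p"] by (cases p) (auto simp: F_def lift_def single_def)
  have sumdiff: "(\<Sum>w\<in>?P. diff w k p) = F p - (if p = (rep v, k) then m else 0)" for p
  proof -
    obtain w l where p: "p = (w, l)" by (cases p)
    have "(\<Sum>w'\<in>?P. diff w' k p) =
        (\<Sum>w'\<in>?P. (if w' = w then (if l = k then 1 else 0) else 0) - (if p = (rep v, k) then 1 else 0))"
      using rP by (intro sum.cong) (auto simp: diff_def p)
    also have "\<dots> = F p - (if p = (rep v, k) then m else 0)"
      using card_part[OF i s] P by (simp add: sum_subtractf F_eq p)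
    finally show ?thesis .
  qed
  have "(\<lambda>p. if p = (v, k) then 1 else 0) =
      (\<lambda>p. diff v k p + 1 / m * (F p - (\<Sum>w\<in>?P. diff w k p)))"
    unfolding sumdiff using m0 by (auto simp: fun_eq_iff diff_def)
  moreover have "(\<lambda>p. diff v k p + 1 / m * (F p - (\<Sum>w\<in>?P. diff w k p))) \<in> basis_span"
    using v k by (intro pointwise_span_add pointwise.span_scale pointwise_span_diff F pointwise_span_sum
      diff_in_span) auto
  ultimately show ?thesis by simp
qed

end

section \<open>Spectrum of a matrix that acts as the stiffness operator\<close>

context crosspolytope_parts
begin

lemma spectrum_mset_stiffness:
  assumes A: "A \<in> carrier_mat (d * (2 * d * m)) (d * (2 * d * m))"
    and vs: "distinct vs" "set vs = U"
    and A_vec: "\<And>f a. a < d * (2 * d * m) \<Longrightarrow>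
      (A *\<^sub>v vec (d * (2 * d * m)) (\<lambda>a. f (vs ! (a div d), a mod d))) $ a =
      stiffness f (vs ! (a div d)) (a mod d)"
  shows "spectrum_mset A = image_mset fst basis"
proof -
  let ?N = "d * (2 * d * m)"
  define e where "e a = (vs ! (a div d), a mod d)" for a
  have len: "length vs = 2 * d * m" using vs card_U distinct_card by metis
  have e: "vs ! (a div d) \<in> U" "a mod d < d" "a div d < length vs" if "a < ?N" for a
  proof -
    show "a mod d < d" using d2 by simp
    show *: "a div d < length vs" using that len by (intro less_mult_imp_div_less) (simp add: mult_ac)
    show "vs ! (a div d) \<in> U" using vs nth_mem[OF *] by simp
  qed
  have inj: "e a = e b \<longleftrightarrow> a = b" if "a < ?N" "b < ?N" for a b
  proof
    assume "e a = e b"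
    hence "a div d = b div d" "a mod d = b mod d"
      using vs(1) e(3)[OF that(1)] e(3)[OF that(2)] by (auto simp: e_def nth_eq_iff_index_eq)
    thus "a = b" by (metis div_mult_mod_eq)
  qed simp
  show ?thesis
  proof (rule spectrum_mset_spanning[OF A, where e = e])
    show "size basis = ?N" by (rule size_basis)
  next
    fix c f assume cf: "(c, f) \<in># basis"
    show "A *\<^sub>v vec ?N (f \<circ> e) = c \<cdot>\<^sub>v vec ?N (f \<circ> e)"
    proof (rule eq_vecI)
      fix a assume "a < dim_vec (c \<cdot>\<^sub>v vec ?N (f \<circ> e))"
      hence a: "a < ?N" by simp
      have "(A *\<^sub>v vec ?N (f \<circ> e)) $ a = stiffness f (vs ! (a div d)) (a mod d)"
        using A_vec[OF a, of f] by (simp add: e_def o_def)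
      also have "\<dots> = c * f (e a)"
        unfolding e_def by (rule stiffness_basis[OF cf e(1,2)[OF a]])
      finally show "(A *\<^sub>v vec ?N (f \<circ> e)) $ a = (c \<cdot>\<^sub>v vec ?N (f \<circ> e)) $ a" using a by simp
    qed (use A in simp)
  next
    fix j assume j: "j < ?N"
    have "(\<lambda>p. if p = e j then 1 else 0) \<in> basis_span"
      using unit_in_span[OF e(1,2)[OF j]] by (simp add: e_def)
    thus "\<exists>f\<in>basis_span. \<forall>i<?N. f (e i) = (if i = j then 1 else 0)"
      by (rule bexI[rotated]) (auto simp: inj j)
  qed
qed

end

section \<open>The spectrum\<close>

text \<open>Distinct crosspolytope vertices on a common axis are opposite, at squared distance 4; on
  different axes the squared distance is 2.\<close>

lemma edge_direction_crosspolytope: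
  assumes "i < d" "j < d" "k < d" "s = 1 \<or> s = -1" "t = 1 \<or> t = -1"
    and p: "p u = s \<cdot>\<^sub>v unit_vec d i" "p v = t \<cdot>\<^sub>v unit_vec d j"
    and ne: "(i, s) \<noteq> (j, t)"
  shows "edge_direction d p u v $ k =
    ((if k = i then s else 0) - (if k = j then t else 0)) / sqrt (if i = j then 4 else 2)"
proof -
  let ?w = "p u - p v"
  have w: "?w $ l = (if l = i then s else 0) - (if l = j then t else 0)" if "l < d" for l
    using that by (simp add: p unit_vec_def)
  have dim: "dim_vec ?w = d" by (simp add: p)
  have "?w \<noteq> 0\<^sub>v d"
  proof
    assume "?w = 0\<^sub>v d"
    hence "?w $ i = 0" using assms(1) by simp
    thus False using w[OF assms(1)] assms(4,5) ne by (auto split: if_splits)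
  qed
  moreover have "p u - p v = 0\<^sub>v d" if "p u = p v"
    unfolding that by (rule eq_vecI) (simp_all add: p)
  ultimately have neq: "p u \<noteq> p v" by blast
  have "?w \<bullet> ?w = (\<Sum>l<d. ((if l = i then s else 0) - (if l = j then t else 0)) *
      ((if l = i then s else 0) - (if l = j then t else 0)))"
    unfolding scalar_prod_def dim lessThan_atLeast0 by (intro sum.cong) (auto simp: w simp del: index_minus_vec)
  \<comment> \<open>The cross term survives only for \<open>i = j\<close> and is shared equally
    between the two indicators.\<close>
  also have "\<dots> = (\<Sum>l<d. (if l = i then s * s - (if i = j then s * t else 0) else 0) +
      (if l = j then t * t - (if i = j then s * t else 0) else 0))"
    by (intro sum.cong) (auto simp: algebra_simps)
  also have "\<dots> = (if i = j then 4 else 2)"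
    using assms(1-5) ne by (simp only: sum.distrib) auto
  finally have "vnorm ?w = sqrt (if i = j then 4 else 2)" by (simp add: vnorm_def)
  thus ?thesis using neq w[OF assms(3)] assms(3) dim by (simp add: edge_direction_def del: index_minus_vec(1))
qed

theorem theorem1p4:
  fixes d n :: nat
    and V :: "nat \<times> int \<Rightarrow> 'v set"
    and q :: "'v \<Rightarrow> real vec"
    and vs :: "'v list"
    and es :: "('v \<times> 'v) list"
  assumes "d \<ge> 2" and "n \<ge> 2 * d" and "2 * d dvd n"
    and "balanced_parts n ({..<d} \<times> {1, -1}) V"
    and "enumerates vs es (complete_multipartite ({..<d} \<times> {1, -1}) V)"
    and "\<And>i s v. i < d \<Longrightarrow> s \<in> {1, -1} \<Longrightarrow> v \<in> V (i, s) \<Longrightarrow> q v = of_int s \<cdot>\<^sub>v unit_vec d i"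
  shows "spectrum_mset (stiffness_matrix d vs es q) =
      replicate_mset (d * (d + 1) div 2) 0
    + replicate_mset (n * (d - 1) - d\<^sup>2) (real n / real (2 * d))
    + replicate_mset (d * (d - 1) div 2) (real n / real d)
    + replicate_mset (n - 1) (real n / 2)
    + replicate_mset 1 (real n)"
proof -
  define I :: "(nat \<times> int) set" where "I = {..<d} \<times> {1, -1}"
  define G where "G = complete_multipartite I V"
  define U where "U = (\<Union>i\<in>I. V i)"
  define m where "m = n div (2 * d)"
  have n: "n = 2 * d * m" using assms(3) by (simp add: m_def)
  have m0: "m > 0" using assms(1,2) by (simp add: n)
  have cardI: "card I = 2 * d" by (simp add: I_def card_cartesian_product)
  have bal: "disjoint_family_on V I" "\<And>i. i \<in> I \<Longrightarrow> finite (V i) \<and> card (V i) = m"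
    using assms(4) cardI unfolding balanced_parts_def I_def[symmetric] m_def by auto
  \<comment> \<open>Disjointness of the family makes the part of a vertex unique, from which axis
    and sign are read off.\<close>
  define part where "part v = (THE i. i \<in> I \<and> v \<in> V i)" for v
  have part_eq: "part v = i" if "i \<in> I" "v \<in> V i" for i v
    unfolding part_def using that bal(1) by (intro the_equality) (auto simp: disjoint_family_on_def)
  define \<iota> where "\<iota> v = fst (part v)" for v
  define \<sigma> where "\<sigma> v = real_of_int (snd (part v))" for v
  have part: "part v \<in> I \<and> v \<in> V (part v)" if "v \<in> U" for v
    using that part_eq by (auto simp: U_def)
  have \<iota>: "\<iota> v < d" and \<sigma>: "\<sigma> v = 1 \<or> \<sigma> v = -1" if "v \<in> U" for v
    using part[OF that] by (auto simp: I_def \<iota>_def \<sigma>_def)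
  have part_iff: "part u = part v \<longleftrightarrow> \<iota> u = \<iota> v \<and> \<sigma> u = \<sigma> v" for u v
    by (auto simp: \<iota>_def \<sigma>_def prod_eq_iff)
  have card_part: "card {v \<in> U. \<iota> v = j \<and> \<sigma> v = t} = m" if jt: "j < d" "t = 1 \<or> t = -1" for j t
  proof -
    obtain s :: int where s: "s = 1 \<or> s = -1" "real_of_int s = t"
      using jt(2) by (metis of_int_1 of_int_minus)
    have js: "(j, s) \<in> I" using s jt by (auto simp: I_def)
    have "v \<in> U \<and> \<iota> v = j \<and> \<sigma> v = t \<longleftrightarrow> v \<in> V (j, s)" for v
    proof
      assume v: "v \<in> U \<and> \<iota> v = j \<and> \<sigma> v = t"
      hence "part v = (j, s)" using s(2) by (auto simp: \<iota>_def \<sigma>_def prod_eq_iff)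
      thus "v \<in> V (j, s)" using part v by metis
    next
      assume "v \<in> V (j, s)"
      thus "v \<in> U \<and> \<iota> v = j \<and> \<sigma> v = t"
        using part_eq[OF js] js s(2) by (auto simp: U_def \<iota>_def \<sigma>_def)
    qed
    thus ?thesis using bal(2)[OF js] by simp
  qed
  have finI: "finite I" by (simp add: I_def)
  interpret crosspolytope_parts d m U \<iota> \<sigma>
    using assms(1) m0 finI bal(2) \<iota> \<sigma> card_part by unfold_locales (auto simp: U_def)
  have enum: "enumerates vs es G" using assms(5) by (simp add: G_def I_def)
  have vs: "distinct vs" "set vs = U"
    using enum by (auto simp: enumerates_def G_def complete_multipartite_def U_def)
  have len: "length vs = n" using vs card_U distinct_card n by metis
  have edge: "{u, v} \<in> snd G \<longleftrightarrow> u \<in> U \<and> v \<in> U \<and> part u \<noteq> part v" for u v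
  proof
    assume "{u, v} \<in> snd G"
    then obtain i j x y where xy: "{u, v} = {x, y}" "i \<in> I" "j \<in> I" "i \<noteq> j" "x \<in> V i" "y \<in> V j"
      unfolding G_def complete_multipartite_def snd_conv mem_Collect_eq by blast
    hence "x \<in> U" "y \<in> U" "part x = i" "part y = j" by (auto simp: U_def part_eq)
    thus "u \<in> U \<and> v \<in> U \<and> part u \<noteq> part v" using xy(1,4) by (auto simp: doubleton_eq_iff)
  next
    assume "u \<in> U \<and> v \<in> U \<and> part u \<noteq> part v"
    thus "{u, v} \<in> snd G" using part unfolding G_def complete_multipartite_def snd_conv by blast
  qed
  have q: "q v = \<sigma> v \<cdot>\<^sub>v unit_vec d (\<iota> v)" if "v \<in> U" for v
    using part[OF that] assms(6)[of "\<iota> v" "snd (part v)" v] by (auto simp: I_def \<iota>_def \<sigma>_def)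
  have "(stiffness_matrix d vs es q *\<^sub>v vec (d * n) (\<lambda>a. f (vs ! (a div d), a mod d))) $ a =
      stiffness f (vs ! (a div d)) (a mod d)" if a: "a < d * n" for f a
  proof -
    let ?u = "vs ! (a div d)" and ?k = "a mod d"
    have u: "?u \<in> U"
    proof -
      have "a div d < length vs" using a len by (intro less_mult_imp_div_less) (simp add: mult_ac)
      thus ?thesis using vs(2) nth_mem by blast
    qed
    have k: "?k < d" using assms(1) by simp
    define g where "g v = ((if ?k = \<iota> ?u then \<sigma> ?u else 0) - (if ?k = \<iota> v then \<sigma> v else 0)) *
      (\<sigma> ?u * (f (?u, \<iota> ?u) - f (v, \<iota> ?u)) - \<sigma> v * (f (?u, \<iota> v) - f (v, \<iota> v))) /
      (if \<iota> ?u = \<iota> v then 4 else 2)" for v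
    have "(stiffness_matrix d vs es q *\<^sub>v vec (d * length vs) (\<lambda>a. f (vs ! (a div d), a mod d))) $ a =
       (\<Sum>v | {?u, v} \<in> snd G. edge_direction d q ?u v $ ?k *
         (\<Sum>l<d. edge_direction d q ?u v $ l * (f (?u, l) - f (v, l))))"
      using enum edge vs(2) q a len by (intro stiffness_matrix_mult_vec) auto
    also have "\<dots> = (\<Sum>v | {?u, v} \<in> snd G. g v)"
    proof (rule sum.cong)
      fix v assume "v \<in> {v. {?u, v} \<in> snd G}"
      hence v: "v \<in> U" and ne: "(\<iota> ?u, \<sigma> ?u) \<noteq> (\<iota> v, \<sigma> v)" using edge part_iff by auto
      define r where "r = sqrt (if \<iota> ?u = \<iota> v then 4 else 2)"
      \<comment> \<open>The direction enters twice, so the two normalizing factors multiply to the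
        squared distance in \<open>g\<close>.\<close>
      have rr: "r * r = (if \<iota> ?u = \<iota> v then 4 else 2)" by (simp add: r_def)
      have dir: "edge_direction d q ?u v $ l =
          ((if l = \<iota> ?u then \<sigma> ?u else 0) - (if l = \<iota> v then \<sigma> v else 0)) / r" if "l < d" for l
        unfolding r_def
        by (rule edge_direction_crosspolytope[where p = q, OF \<iota>[OF u] \<iota>[OF v] that \<sigma>[OF u] \<sigma>[OF v] q[OF u] q[OF v] ne])
      have "(\<Sum>l<d. edge_direction d q ?u v $ l * (f (?u, l) - f (v, l))) =
          (\<Sum>l<d. (if l = \<iota> ?u then \<sigma> ?u * (f (?u, l) - f (v, l)) / r else 0) -
            (if l = \<iota> v then \<sigma> v * (f (?u, l) - f (v, l)) / r else 0))"
        by (intro sum.cong) (auto simp: dir diff_divide_distrib left_diff_distrib)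
      also have "\<dots> = (\<sigma> ?u * (f (?u, \<iota> ?u) - f (v, \<iota> ?u)) - \<sigma> v * (f (?u, \<iota> v) - f (v, \<iota> v))) / r"
        using \<iota>[OF u] \<iota>[OF v] by (simp add: sum_subtractf diff_divide_distrib)
      finally show "edge_direction d q ?u v $ ?k *
         (\<Sum>l<d. edge_direction d q ?u v $ l * (f (?u, l) - f (v, l))) = g v"
        unfolding dir[OF k] g_def rr[symmetric] by simp
    qed simp
    also have "\<dots> = (\<Sum>v\<in>U. g v)"
    proof (rule sum.mono_neutral_left)
      show "finite U" by (rule finite_U)
      show "{v. {?u, v} \<in> snd G} \<subseteq> U" using edge by blast
      show "\<forall>v\<in>U - {v. {?u, v} \<in> snd G}. g v = 0"
      proof
        fix v assume "v \<in> U - {v. {?u, v} \<in> snd G}"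
        hence "\<iota> ?u = \<iota> v" "\<sigma> ?u = \<sigma> v" using edge part_iff u by auto
        thus "g v = 0" by (simp add: g_def)
      qed
    qed
    finally show ?thesis by (simp add: stiffness_def g_def len)
  qed
  moreover have "stiffness_matrix d vs es q \<in> carrier_mat (d * n) (d * n)"
    using stiffness_matrix_carrier[of d vs es q] by (simp add: len)
  ultimately have "spectrum_mset (stiffness_matrix d vs es q) = image_mset fst basis"
    using spectrum_mset_stiffness[OF _ vs] unfolding n by blast
  moreover have "real n / real (2 * d) = real m" "real n / real d = 2 * real m"
    "real n / 2 = real d * real m" "real n = 2 * real d * real m"
    using assms(1) by (simp_all add: n)
  ultimately show ?thesis unfolding fst_basis by (simp add: n)
qed

end
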